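(* Let $p$ be a prime number, let $r$ be a positive integer, and let $\Delta \subset \mathbb{R}^d$ be a $d$-dimensional Gorenstein simplex of index $r$ whose normalized volume equals $p$. Suppose that $\Delta$ is not a lattice pyramid over any lower-dimensional lattice simplex, and let $t$ be the unique interior lattice point of $r\Delta$. Then $\mathrm{Vol}((r\Delta - t)^\vee) = rp^d$.
   Context: A lattice polytope is a convex polytope all of whose vertices have integer coordinates. $\mathrm{Vol}(\mathcal{P})$ denotes the normalized volume, i.e. $d!$ times the Euclidean volume of a $d$-dimensional lattice polytope $\mathcal{P}\subset\mathbb{R}^d$. Two $d$-dimensional lattice polytopes in $\mathbb{R}^d$ are unimodularly equivalent if one is obtained from the other by $v \mapsto vU + w$ with $U \in \mathbb{Z}^{d\times d}$, $\det U = \pm 1$, $w \in \mathbb{Z}^d$. The lattice pyramid over $\mathcal{P}\subset\mathbb{R}^{d-1}$ is $\mathrm{Pyr}(\mathcal{P}) = \mathrm{conv}(\mathcal{P}\times\{0\}, (0,\ldots,0,1)) \subset \mathbb{R}^{d}$; $\Delta$ is called a lattice pyramid over a lower-dimensional lattice simplex if it is unimodularly equivalent to $\mathrm{Pyr}(\Delta')$ for some lattice simplex $\Delta'$ of dimension $d-1$. The dual polytope of $\mathcal{Q}\subset\mathbb{R}^d$ is $\mathcal{Q}^\vee = \{y \in \mathbb{R}^d : \langle x,y\rangle \le 1 \text{ for all } x \in \mathcal{Q}\}$. A $d$-dimensional lattice polytope $\mathcal{Q}$ is reflexive if the origin is the unique lattice point in its interior and $\mathcal{Q}^\vee$ is also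 a lattice polytope. A $d$-dimensional lattice polytope $\mathcal{P} \subset \mathbb{R}^d$ is Gorenstein of index $r$ ($r \in \mathbb{Z}_{>0}$) if there exist a reflexive polytope $\mathcal{Q} \subset \mathbb{R}^d$ and $w \in \mathbb{Z}^d$ with $\mathcal{Q} = r\mathcal{P} + w$; then $r\mathcal{P}$ has a unique interior lattice point $t$ and $\mathcal{Q} = r\mathcal{P} - t$. A Gorenstein simplex is a lattice simplex that is Gorenstein. *)

theory Defs
  imports "HOL-Analysis.Analysis" "HOL-Computational_Algebra.Primes"
begin

text \<open>The ambient space of dimension d is \<open>real ^ 'n\<close> with d the cardinality of the index type.\<close>

definition integer_points :: "(real ^ 'n) set" where
  "integer_points = {x. \<forall>i. x $ i \<in> \<int>}"

definition lattice_polytope :: "(real ^ 'n) set \<Rightarrow> bool" where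
  "lattice_polytope P \<longleftrightarrow> polytope P \<and> (\<forall>v. v extreme_point_of P \<longrightarrow> v \<in> integer_points)"

definition full_lattice_polytope :: "(real ^ 'n) set \<Rightarrow> bool" where
  "full_lattice_polytope P \<longleftrightarrow> lattice_polytope P \<and> aff_dim P = int CARD('n)"

definition lattice_simplex :: "int \<Rightarrow> (real ^ 'n) set \<Rightarrow> bool" where
  "lattice_simplex k S \<longleftrightarrow> k simplex S \<and> lattice_polytope S"

definition normalized_volume :: "(real ^ 'n) set \<Rightarrow> real" where
  "normalized_volume P = fact CARD('n) * measure lebesgue P"

definition unimodularly_equivalent :: "(real ^ 'n) set \<Rightarrow> (real ^ 'n) set \<Rightarrow> bool" where
  "unimodularly_equivalent P Q \<longleftrightarrow>
     (\<exists>(U :: real ^ 'n ^ 'n) w. (\<forall>i j. U $ i $ j \<in> \<int>) \<and> (det U = 1 \<or> det U = - 1) \<and>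
        w \<in> integer_points \<and> Q = (\<lambda>v. v v* U + w) ` P)"

text \<open>
  The index type has no distinguished last element and no type for dimension d - 1, so the copy of
  the space of dimension d - 1 at height 0 is the coordinate hyperplane of any chosen coordinate k,
  and k is the height coordinate of the pyramid. This includes the case d = 1, where the base is
  the single point 0. The choice of k is immaterial up to a permutation of coordinates, which is
  unimodular.
\<close>

definition coordinate_hyperplane :: "'n \<Rightarrow> (real ^ 'n) set" where
  "coordinate_hyperplane k = {x. x $ k = 0}"

definition lattice_pyramid :: "'n \<Rightarrow> (real ^ 'n) set \<Rightarrow> (real ^ 'n) set" where
  "lattice_pyramid k B = convex hull (insert (axis k 1) B)"

definition is_lattice_pyramid_over_simplex :: "(real ^ 'n) set \<Rightarrow> bool" where
  "is_lattice_pyramid_over_simplex S \<longleftrightarrow>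
     (\<exists>k B. B \<subseteq> coordinate_hyperplane k \<and> lattice_simplex (int CARD('n) - 1) B \<and>
        unimodularly_equivalent S (lattice_pyramid k B))"

definition dual_polytope :: "(real ^ 'n) set \<Rightarrow> (real ^ 'n) set" where
  "dual_polytope Q = {y. \<forall>x\<in>Q. x \<bullet> y \<le> 1}"

definition interior_lattice_points :: "(real ^ 'n) set \<Rightarrow> (real ^ 'n) set" where
  "interior_lattice_points P = interior P \<inter> integer_points"

definition reflexive_polytope :: "(real ^ 'n) set \<Rightarrow> bool" where
  "reflexive_polytope Q \<longleftrightarrow> full_lattice_polytope Q \<and> interior_lattice_points Q = {0} \<and>
     lattice_polytope (dual_polytope Q)"

definition gorenstein :: "nat \<Rightarrow> (real ^ 'n) set \<Rightarrow> bool" where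
  "gorenstein r P \<longleftrightarrow> r > 0 \<and> full_lattice_polytope P \<and>
     (\<exists>Q w. reflexive_polytope Q \<and> w \<in> integer_points \<and> Q = (\<lambda>x. real r *\<^sub>R x + w) ` P)"

end

theory Submission
  imports Defs
begin

text \<open>
  Let \<open>C\<close> be the vertex set of \<open>\<Delta>\<close>, of size \<open>d + 1\<close>. Each vertex \<open>a\<close> has a barycentric coordinate,
  the affine function that is 1 at \<open>a\<close> and 0 at the other vertices; let \<open>g a\<close> be its gradient.
  The edges of \<open>\<Delta>\<close> from one vertex span a sublattice of index \<open>p\<close>, so Cramer's rule shows that
  \<open>p *\<^sub>R g a\<close> is integral (\<open>barycentric_gradients_exist\<close>). If \<open>g a\<close> were integral itself, \<open>\<Delta>\<close> would
  have lattice height 1 over the facet opposite to \<open>a\<close>; completing \<open>g a\<close> to a unimodular matrix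
  would then exhibit \<open>\<Delta>\<close> as a lattice pyramid with apex \<open>a\<close>
  (\<open>lattice_pyramid_if_integral_facet_functional\<close>).

  Write \<open>t = (\<Sum>c\<in>C. \<gamma> c *\<^sub>R c)\<close> with \<open>\<gamma> > 0\<close> of total \<open>r\<close>. The vertices of the dual of \<open>r\<Delta> - t\<close> are
  \<open>- (1 / \<gamma> a) *\<^sub>R g a\<close> (\<open>dual_simplex\<close>), and reflexivity makes them integral. Pairing such a vertex
  with an edge at \<open>a\<close> gives that \<open>1 / \<gamma> a\<close> is an integer, and evaluating the barycentric
  coordinate at the lattice point \<open>t\<close> gives that \<open>p * \<gamma> a\<close> is an integer. Hence \<open>1 / \<gamma> a\<close> is a
  divisor of the prime \<open>p\<close>. It is not 1, for then \<open>g a\<close> would be integral. So every \<open>\<gamma> a\<close> is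
  \<open>1 / p\<close>; summing over \<open>C\<close> gives \<open>d + 1 = r * p\<close>.

  The dual simplex thus has the vertices \<open>- p *\<^sub>R g a\<close>, whose sum is 0. Splitting it from the origin into
  \<open>d + 1\<close> simplices of equal volume corresponds to the determinant identity
  \<open>det_mat_1_plus_ones\<close>; each piece has normalized volume \<open>p ^ d\<close> times the determinant \<open>1 / p\<close> of
  the basis dual to the edges. Altogether the volume is \<open>(d + 1) * p ^ d / p = r * p ^ d\<close>.
\<close>

section \<open>Volumes of linear images and of simplices\<close>

lemma det_shear:
  fixes m n :: "'n::finite"
  assumes "m \<noteq> n"
  shows "det (matrix (\<lambda>x::real^'n. \<chi> i. if i = m then x $ m + x $ n else x $ i)) = 1"
proof -
  have "matrix (\<lambda>x::real^'n. \<chi> i. if i = m then x $ m + x $ n else x $ i) =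
        (\<chi> k. if k = m then row m (mat 1) + 1 *s row n (mat 1) else row k (mat 1))"
    by (auto simp: matrix_def vec_eq_iff mat_def row_def axis_def)
  then show ?thesis
    using det_row_operation[OF assms, of "mat 1 :: real^'n^'n" 1] by simp
qed

lemma det_coordinate_swap:
  fixes m n :: "'n::finite"
  shows "\<bar>det (matrix (\<lambda>x::real^'n. \<chi> i. x $ Transposition.transpose m n i))\<bar> = 1"
proof -
  have "matrix (\<lambda>x::real^'n. \<chi> i. x $ Transposition.transpose m n i) =
        (\<chi> i. mat 1 $ Transposition.transpose m n i)"
    by (auto simp: matrix_def vec_eq_iff mat_def axis_def)
  then show ?thesis
    by (simp add: det_permute_rows[OF permutes_swap_id] sign_swap_id)
qed

text \<open>
  The shear is measure preserving on a box whose \<open>n\<close>-th coordinates are nonnegative; a translation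
  along the \<open>n\<close>-th axis reduces every other box to this case, because the shear carries
  translations to translations.
\<close>

lemma measure_shear_cbox:
  fixes a b :: "real^'n" and m n :: "'n::finite"
  assumes "m \<noteq> n"
  shows "measure lebesgue ((\<lambda>x. \<chi> i. if i = m then x $ m + x $ n else x $ i) ` cbox a b)
       = measure lebesgue (cbox a b)" (is "measure _ (?h ` _) = _")
proof (cases "cbox a b = {}")
  case False
  define w :: "real^'n" where "w = - (a $ n) *\<^sub>R axis n 1"
  have lin: "linear ?h"
    by (rule linearI) (auto simp: vec_eq_iff algebra_simps)
  have box: "(+) w ` cbox a b = cbox (w + a) (w + b)"
    by (rule cbox_translation[symmetric])
  have "?h ` (+) w ` cbox a b = (+) (?h w) ` ?h ` cbox a b"
    unfolding image_image by (simp add: linear_add[OF lin])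
  then have "measure lebesgue (?h ` cbox a b) = measure lebesgue (?h ` cbox (w + a) (w + b))"
    by (simp only: box[symmetric] measure_translation)
  also have "\<dots> = measure lebesgue (cbox (w + a) (w + b))"
    using False box by (intro measure_shear_interval[OF assms]) (auto simp: w_def)
  also have "\<dots> = measure lebesgue (cbox a b)"
    by (simp only: box[symmetric] measure_translation)
  finally show ?thesis .
qed simp

lemma measure_coordinate_swap_cbox:
  fixes a b :: "real^'n" and m n :: "'n::finite"
  shows "measure lebesgue ((\<lambda>x. \<chi> i. x $ Transposition.transpose m n i) ` cbox a b)
       = measure lebesgue (cbox a b)"
proof (cases "cbox a b = {}")
  case False
  define h :: "real^'n \<Rightarrow> real^'n" where "h = (\<lambda>x. \<chi> i. x $ Transposition.transpose m n i)"
  have hh: "h (h x) = x" for x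
    by (simp add: h_def vec_eq_iff)
  have h_box: "h x \<in> cbox (h c) (h d)" if "x \<in> cbox c d" for x c d
    using that by (simp add: h_def mem_box_cart)
  have eq: "h ` cbox a b = cbox (h a) (h b)"
  proof
    show "h ` cbox a b \<subseteq> cbox (h a) (h b)"
      using h_box by blast
    show "cbox (h a) (h b) \<subseteq> h ` cbox a b"
      using h_box[of _ "h a" "h b"] hh by (metis image_eqI subsetI)
  qed
  have prod_eq: "(\<Prod>i\<in>UNIV. h b $ i - h a $ i) = (\<Prod>i\<in>UNIV. b $ i - a $ i)"
    using prod.permute[OF permutes_swap_id, of m UNIV n "\<lambda>i. b $ i - a $ i"]
    by (simp add: o_def h_def)
  have ne: "cbox (h a) (h b) \<noteq> {}"
    using False eq by blast
  show ?thesis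
    unfolding h_def[symmetric] eq using False ne prod_eq
    by (simp add: content_cbox_cart)
qed simp

text \<open>
  Both sides are multiplicative under composition, so it is enough to treat the maps that generate
  all linear maps: those with a vanishing coordinate, diagonal maps, coordinate swaps and shears.
\<close>

lemma lmeasurable_measure_linear_image:
  fixes f :: "real^'n \<Rightarrow> real^'n"
  assumes "linear f" "S \<in> lmeasurable"
  shows "f ` S \<in> lmeasurable \<and> measure lebesgue (f ` S) = \<bar>det (matrix f)\<bar> * measure lebesgue S"
proof -
  let ?P = "\<lambda>f::real^'n \<Rightarrow> real^'n. \<forall>S\<in>lmeasurable.
    f ` S \<in> lmeasurable \<and> measure lebesgue (f ` S) = \<bar>det (matrix f)\<bar> * measure lebesgue S"
  have unimodular: "?P h"
    if "linear h" "\<bar>det (matrix h)\<bar> = 1"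
       "\<And>a b. measure lebesgue (h ` cbox a b) = measure lebesgue (cbox a b)" for h
  proof
    fix S :: "(real^'n) set"
    assume "S \<in> lmeasurable"
    then show "h ` S \<in> lmeasurable \<and> measure lebesgue (h ` S) = \<bar>det (matrix h)\<bar> * measure lebesgue S"
      using measure_linear_sufficient[OF that(1), of S 1] that(2,3) by simp
  qed
  have "?P f"
  proof (rule induct_linear_elementary[OF assms(1), of ?P])
    fix f g :: "real^'n \<Rightarrow> real^'n"
    assume lin: "linear f" "linear g" and f: "?P f" and g: "?P g"
    show "?P (f \<circ> g)"
    proof
      fix S :: "(real^'n) set"
      assume "S \<in> lmeasurable"
      then have "f ` g ` S \<in> lmeasurable \<and>
        measure lebesgue (f ` g ` S) = \<bar>det (matrix f)\<bar> * (\<bar>det (matrix g)\<bar> * measure lebesgue S)"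
        using f g by metis
      then show "(f \<circ> g) ` S \<in> lmeasurable \<and>
        measure lebesgue ((f \<circ> g) ` S) = \<bar>det (matrix (f \<circ> g))\<bar> * measure lebesgue S"
        by (simp only: image_comp matrix_compose[OF lin(2,1)] det_mul abs_mult mult.assoc)
    qed
  next
    fix f :: "real^'n \<Rightarrow> real^'n" and i
    assume f: "linear f" "\<And>x. f x $ i = 0"
    then have "\<not> surj f"
      by (metis surjE vec_component zero_neq_one)
    then have inj: "\<not> inj f"
      using linear_injective_imp_surjective[OF f(1)] by blast
    then have "negligible (f ` S)" for S
      by (rule negligible_linear_singular_image[OF f(1)])
    then show "?P f"
      using inj det_nz_iff_inj[OF f(1)]
      by (auto simp: negligible_imp_measure0 negligible_imp_measurable)
  next
    fix c :: "'n \<Rightarrow> real"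
    have "det (matrix (\<lambda>x::real^'n. \<chi> i. c i * x $ i)) = prod c UNIV"
      by (subst det_diagonal) (auto simp: matrix_def axis_def)
    then show "?P (\<lambda>x. \<chi> i. c i * x $ i)"
      by (simp add: measurable_stretch measure_stretch)
  next
    fix m n :: 'n assume "m \<noteq> n"
    have "linear (\<lambda>x::real^'n. \<chi> i. x $ Transposition.transpose m n i)"
      by (rule linearI) (auto simp: vec_eq_iff)
    then show "?P (\<lambda>x. \<chi> i. x $ Transposition.transpose m n i)"
      by (rule unimodular[OF _ det_coordinate_swap measure_coordinate_swap_cbox])
    have "linear (\<lambda>x::real^'n. \<chi> i. if i = m then x $ m + x $ n else x $ i)"
      by (rule linearI) (auto simp: vec_eq_iff algebra_simps)
    moreover have "\<bar>det (matrix (\<lambda>x::real^'n. \<chi> i. if i = m then x $ m + x $ n else x $ i))\<bar> = 1"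
      by (simp add: det_shear[OF \<open>m \<noteq> n\<close>])
    ultimately show "?P (\<lambda>x. \<chi> i. if i = m then x $ m + x $ n else x $ i)"
      by (rule unimodular[OF _ _ measure_shear_cbox[OF \<open>m \<noteq> n\<close>]])
  qed
  with assms(2) show ?thesis by blast
qed

text \<open>
  The simplex is the image of the standard simplex, whose volume is \<open>1 / fact d\<close>, under the affine map
  that takes the basis vectors to the \<open>v i\<close> and the origin to \<open>v0\<close>. The formula also covers
  degenerate simplices, for which both sides are 0.
\<close>

lemma normalized_volume_simplex:
  fixes v0 :: "real^'n" and v :: "'n \<Rightarrow> real^'n"
  shows "normalized_volume (convex hull (insert v0 (range v))) = \<bar>det (\<chi> i. v i - v0)\<bar>"
proof -
  define std :: "(real^'n) set" where "std = convex hull (insert 0 Basis)"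
  define A where "A = transpose (\<chi> i. v i - v0)"
  have compact: "compact std"
    unfolding std_def by (intro finite_imp_compact_convex_hull) auto
  have A_axis: "A *v axis i 1 = v i - v0" for i
    by (simp add: A_def matrix_vector_mult_basis column_def transpose_def vec_eq_iff)
  have Basis_eq: "(Basis :: (real^'n) set) = range (\<lambda>i. axis i 1)"
    by (auto simp: Basis_vec_def)
  have "(*v) A ` insert 0 Basis = insert 0 (range (\<lambda>i. v i - v0))"
    unfolding Basis_eq by (simp add: A_axis image_image)
  then have "(+) v0 ` (*v) A ` insert 0 Basis = insert v0 (range v)"
    by (auto simp: image_image)
  then have "convex hull (insert v0 (range v)) = (+) v0 ` (*v) A ` std"
    by (metis std_def convex_hull_linear_image convex_hull_translation matrix_vector_mul_linear)
  then have "measure lebesgue (convex hull (insert v0 (range v))) = measure lebesgue ((*v) A ` std)"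
    by (simp only: measure_translation)
  also have "\<dots> = \<bar>det A\<bar> * measure lebesgue std"
    using lmeasurable_measure_linear_image[OF matrix_vector_mul_linear lmeasurable_compact[OF compact]]
    by (metis matrix_of_matrix_vector_mul)
  also have "measure lebesgue std = 1 / fact CARD('n)"
    using compact content_std_simplex[where 'a = "real^'n"]
    by (simp add: std_def compact_imp_closed borel_closed)
  finally show ?thesis
    by (simp add: normalized_volume_def A_def det_transpose)
qed

section \<open>Completing an integer vector to a unimodular matrix\<close>

text \<open>
  This one shape covers elementary row operations, rescalings of a row, and the shears
  that clear a row in one go.
\<close>

definition identity_with_row :: "'n \<Rightarrow> real^'n \<Rightarrow> real^'n^'n" where
  "identity_with_row k r = (\<chi> i. if i = k then r else axis i 1)"

lemma identity_with_row_nth: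
  "identity_with_row k r $ i $ j = (if i = k then r $ j else if i = j then 1 else 0)"
  by (simp add: identity_with_row_def axis_def)

lemma det_identity_with_row:
  fixes r :: "real^'n"
  shows "det (identity_with_row k r) = r $ k"
proof -
  have row: "row i (mat 1 :: real^'n^'n) = axis i 1" for i
    by (auto simp: row_def mat_def axis_def vec_eq_iff)
  have "identity_with_row k r =
        (\<chi> i. if i = k then \<Sum>j\<in>UNIV. r $ j *s row j (mat 1) else row i (mat 1))"
    unfolding identity_with_row_def row basis_expansion ..
  then show ?thesis
    using cramer_lemma_transpose[of k r "mat 1"] by simp
qed

lemma identity_with_row_mult_vec:
  "identity_with_row k r *v x = (\<chi> i. if i = k then r \<bullet> x else x $ i)"
  by (simp add: vec_eq_iff matrix_vector_mul_component identity_with_row_def inner_axis')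

lemma vec_mult_identity_with_row:
  "x v* identity_with_row k r = x + x $ k *\<^sub>R (r - axis k 1)"
proof -
  have "(\<Sum>i\<in>UNIV. identity_with_row k r $ i $ j * x $ i) =
        (\<Sum>i\<in>UNIV. (if i = k then x $ k * (r $ j - axis k 1 $ j) else 0) + (if i = j then x $ i else 0))" for j
    by (rule sum.cong) (auto simp: identity_with_row_nth axis_def algebra_simps)
  then show ?thesis
    by (simp add: vec_eq_iff vector_matrix_mult_def sum.distrib mult.commute)
qed

definition unimodular :: "real^'n^'n \<Rightarrow> bool" where
  "unimodular U \<longleftrightarrow> (\<forall>i j. U $ i $ j \<in> \<int>) \<and> (det U = 1 \<or> det U = - 1)"

lemma unimodular_mult: "unimodular U \<Longrightarrow> unimodular V \<Longrightarrow> unimodular (U ** V)"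
  unfolding unimodular_def det_mul
  by (auto simp: matrix_matrix_mult_def intro!: Ints_sum)

lemma unimodular_identity_with_row:
  assumes "r \<in> integer_points" "r $ k = 1 \<or> r $ k = - 1"
  shows "unimodular (identity_with_row k r)"
  using assms by (auto simp: unimodular_def det_identity_with_row identity_with_row_nth integer_points_def)

lemma unimodular_mat_1: "unimodular (mat 1)"
  unfolding unimodular_def det_I by (auto simp: mat_def)

lemma integer_points_add: "x \<in> integer_points \<Longrightarrow> y \<in> integer_points \<Longrightarrow> x + y \<in> integer_points"
  and integer_points_diff: "x \<in> integer_points \<Longrightarrow> y \<in> integer_points \<Longrightarrow> x - y \<in> integer_points"
  and integer_points_uminus: "x \<in> integer_points \<Longrightarrow> - x \<in> integer_points"
  and integer_points_scaleR: "c \<in> \<int> \<Longrightarrow> x \<in> integer_points \<Longrightarrow> c *\<^sub>R x \<in> integer_points"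
  by (auto simp: integer_points_def)

lemma integer_points_axis: "axis k 1 \<in> integer_points"
  by (auto simp: integer_points_def axis_def)

lemma inner_integer_points: "x \<in> integer_points \<Longrightarrow> y \<in> integer_points \<Longrightarrow> x \<bullet> y \<in> \<int>"
  by (auto simp: integer_points_def inner_vec_def intro!: Ints_sum)

lemma integer_points_vec_mult:
  "x \<in> integer_points \<Longrightarrow> unimodular U \<Longrightarrow> x v* U \<in> integer_points"
  by (auto simp: integer_points_def unimodular_def vector_matrix_mult_def intro!: Ints_sum)

text \<open>
  One step of the Euclidean algorithm on the entries of \<open>x\<close>: being an integral multiple of the
  \<open>k\<close>-th column of a unimodular matrix can be pulled back along an integral row operation, since the
  inverse operation is again unimodular.
\<close>

lemma column_multiple_row_operation:
  fixes x :: "real^'n"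
  assumes "i \<noteq> j" "c \<in> \<int>"
    and "\<exists>U m. unimodular U \<and> m \<in> \<int> \<and> x + (c * x $ j) *\<^sub>R axis i 1 = m *\<^sub>R column k U"
  shows "\<exists>U m. unimodular U \<and> m \<in> \<int> \<and> x = m *\<^sub>R column k U"
proof -
  define y where "y = x + (c * x $ j) *\<^sub>R axis i 1"
  obtain U m where U: "unimodular U" "m \<in> \<int>" "y = m *\<^sub>R column k U"
    using assms(3) y_def by blast
  define E where "E = identity_with_row i (axis i 1 + (- c) *\<^sub>R axis j 1)"
  have "unimodular E"
    unfolding E_def using assms(1,2)
    by (intro unimodular_identity_with_row integer_points_add integer_points_scaleR integer_points_axis)
       (auto simp: axis_def)
  have "x = E *v y"
    using assms(1)
    unfolding E_def identity_with_row_mult_vec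
    by (simp add: vec_eq_iff inner_diff_left inner_axis' y_def; simp add: axis_def)
  also have "\<dots> = m *\<^sub>R column k (E ** U)"
    by (simp add: U(3) matrix_vector_mult_scaleR matrix_vector_mult_basis[symmetric] matrix_vector_mul_assoc)
  finally show ?thesis
    using unimodular_mult[OF \<open>unimodular E\<close> U(1)] U(2) by blast
qed

text \<open>
  The Euclidean algorithm: as long as two entries are nonzero, subtracting one from the other (up to
  sign) lowers the sum of the absolute values. It ends with a single nonzero entry, which two more
  row operations move to position \<open>k\<close>. The multiple \<open>m\<close> is, up to sign, the gcd of the entries.
\<close>

lemma integer_vector_multiple_of_unimodular_column:
  fixes h :: "'n::finite \<Rightarrow> int"
  shows "\<exists>U m. unimodular U \<and> m \<in> \<int> \<and> (\<chi> i. real_of_int (h i)) = m *\<^sub>R column k U"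
proof (induction "nat (\<Sum>i\<in>UNIV. \<bar>h i\<bar>)" arbitrary: h rule: less_induct)
  case less
  let ?v = "\<lambda>h::'n \<Rightarrow> int. (\<chi> i. real_of_int (h i)) :: real^'n"
  show ?case
  proof (cases "\<exists>i j. i \<noteq> j \<and> h i \<noteq> 0 \<and> h j \<noteq> 0")
    case True
    then obtain a b where ab: "a \<noteq> b" "h a \<noteq> 0" "h b \<noteq> 0" by blast
    obtain i j where ij: "i \<noteq> j" "h i \<noteq> 0" "h j \<noteq> 0" "\<bar>h j\<bar> \<le> \<bar>h i\<bar>"
      using that[of a b] that[of b a] ab by (cases "\<bar>h b\<bar> \<le> \<bar>h a\<bar>") auto
    define c where "c = - sgn (h i) * sgn (h j)"
    define h' where "h' = h(i := h i + c * h j)"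
    have "\<bar>h' i\<bar> < \<bar>h i\<bar>"
      using ij by (auto simp: h'_def c_def sgn_if abs_if split: if_splits)
    then have "(\<Sum>i\<in>UNIV. \<bar>h' i\<bar>) < (\<Sum>i\<in>UNIV. \<bar>h i\<bar>)"
      by (intro sum_strict_mono_ex1) (auto simp: h'_def)
    moreover have "0 \<le> (\<Sum>i\<in>UNIV. \<bar>h' i\<bar>)"
      by (simp add: sum_nonneg)
    ultimately have "nat (\<Sum>i\<in>UNIV. \<bar>h' i\<bar>) < nat (\<Sum>i\<in>UNIV. \<bar>h i\<bar>)"
      by linarith
    then have "\<exists>U m. unimodular U \<and> m \<in> \<int> \<and> ?v h' = m *\<^sub>R column k U"
      by (rule less)
    moreover have "?v h' = ?v h + (of_int c * ?v h $ j) *\<^sub>R axis i 1"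
      by (auto simp: vec_eq_iff h'_def axis_def)
    ultimately have "\<exists>U m. unimodular U \<and> m \<in> \<int> \<and>
        ?v h + (of_int c * ?v h $ j) *\<^sub>R axis i 1 = m *\<^sub>R column k U"
      by simp
    then show ?thesis
      by (rule column_multiple_row_operation[OF ij(1) Ints_of_int])
  next
    case False
    show ?thesis
    proof (cases "\<forall>i. i \<noteq> k \<longrightarrow> h i = 0")
      case True
      then have "?v h = of_int (h k) *\<^sub>R column k (mat 1)"
        by (auto simp: vec_eq_iff column_def mat_def)
      then show ?thesis
        using unimodular_mat_1 by (metis Ints_of_int)
    next
      case nonzero: False
      then obtain i where i: "i \<noteq> k" "h i \<noteq> 0" by blast
      with False have h0: "h j = 0" if "j \<noteq> i" for j using that by blast
      \<comment> \<open>The entry is first copied from position i to position k, then erased at position i.\<close>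
      let ?x = "?v h + (1 * ?v h $ i) *\<^sub>R axis k 1"
      have "?x + ((-1) * ?x $ k) *\<^sub>R axis i 1 = of_int (h i) *\<^sub>R column k (mat 1)"
        using i h0 by (auto simp: vec_eq_iff column_def mat_def axis_def)
      then have "\<exists>U m. unimodular U \<and> m \<in> \<int> \<and> ?x + ((-1) * ?x $ k) *\<^sub>R axis i 1 = m *\<^sub>R column k U"
        using unimodular_mat_1 by (metis Ints_of_int)
      then have "\<exists>U m. unimodular U \<and> m \<in> \<int> \<and> ?x = m *\<^sub>R column k U"
        by (rule column_multiple_row_operation[OF i(1), rotated]) simp
      then show ?thesis
        by (rule column_multiple_row_operation[OF i(1)[symmetric] Ints_1])
    qed
  qed
qed

text \<open>
  A vector \<open>g\<close> with \<open>g \<bullet> h = 1\<close> for some integral \<open>h\<close> is primitive, so it is plus or minus the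
  \<open>k\<close>-th column of a unimodular matrix. In the resulting coordinates \<open>h\<close> has \<open>k\<close>-th entry plus or
  minus 1; a shear that fixes the \<open>k\<close>-th column up to this sign moves \<open>h\<close> to the basis vector.
\<close>

lemma unimodular_completion:
  fixes g h :: "real^'n"
  assumes g: "g \<in> integer_points" and h: "h \<in> integer_points" and gh: "g \<bullet> h = 1"
  obtains U where "unimodular U" "U *v axis k 1 = g" "h v* U = axis k 1"
proof -
  have "g = (\<chi> i. real_of_int \<lfloor>g $ i\<rfloor>)"
    using g by (auto simp: vec_eq_iff integer_points_def elim!: Ints_cases)
  then obtain U m where U: "unimodular U" "m \<in> \<int>" "g = m *\<^sub>R column k U"
    using integer_vector_multiple_of_unimodular_column[of "\<lambda>i. \<lfloor>g $ i\<rfloor>" k] by metis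
  define h' where "h' = h v* U"
  have h': "h' \<in> integer_points"
    unfolding h'_def by (rule integer_points_vec_mult[OF h U(1)])
  have h'k: "h' $ k = h \<bullet> column k U"
    by (simp add: h'_def vector_matrix_mult_def inner_vec_def column_def mult.commute)
  have "m * h' $ k = 1"
    using gh by (simp add: U(3) h'k inner_commute)
  moreover have "h' $ k \<in> \<int>"
    using h' by (simp add: integer_points_def)
  ultimately have m: "m = 1 \<and> h' $ k = 1 \<or> m = - 1 \<and> h' $ k = - 1"
    using U(2)
    by (elim Ints_cases) (metis of_int_1 of_int_eq_iff of_int_minus of_int_mult zmult_eq_1_iff)
  \<comment> \<open>Row k of S subtracts the remaining entries of the transformed h, and its factor m corrects the
    sign of column k.\<close>
  define S where "S = identity_with_row k (m *\<^sub>R (axis k 1 - (h' - h' $ k *\<^sub>R axis k 1)))"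
  have "unimodular S"
    unfolding S_def using m h'
    by (intro unimodular_identity_with_row integer_points_scaleR integer_points_diff integer_points_axis)
       (auto simp: axis_def)
  then have US: "unimodular (U ** S)"
    using U(1) unimodular_mult by blast
  have S_axis: "S *v axis k 1 = m *\<^sub>R axis k 1"
    unfolding S_def identity_with_row_mult_vec using m
    by (auto simp: vec_eq_iff inner_axis; simp add: axis_def)
  have "(U ** S) *v axis k 1 = U *v (S *v axis k 1)"
    by (simp only: matrix_vector_mul_assoc)
  also have "\<dots> = g"
    by (simp only: S_axis matrix_vector_mult_scaleR) (simp only: matrix_vector_mult_basis U(3))
  finally have US_g: "(U ** S) *v axis k 1 = g" .
  have "h' v* S = axis k 1"
    unfolding S_def vec_mult_identity_with_row using m by (auto simp: algebra_simps)
  then have "h v* (U ** S) = axis k 1"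
    by (simp add: h'_def vector_matrix_mul_assoc)
  with US US_g show ?thesis
    by (rule that)
qed

section \<open>Simplices of lattice height one are pyramids\<close>

text \<open>
  The functional \<open>g\<close> measures the lattice height over the facet opposite to \<open>a\<close>. A unimodular change of
  coordinates makes it the \<open>k\<close>-th coordinate and sends the edge from a facet vertex \<open>b\<close> to \<open>a\<close> to the
  \<open>k\<close>-th basis vector; moving \<open>b\<close> to the origin then puts the facet at height 0 and \<open>a\<close> at the apex.
\<close>

lemma lattice_pyramid_if_integral_facet_functional:
  fixes C :: "(real^'n) set"
  assumes indep: "\<not> affine_dependent C" and card: "card C = CARD('n) + 1"
    and C: "C \<subseteq> integer_points" and a: "a \<in> C"
    and g: "g \<in> integer_points" "\<And>c. c \<in> C - {a} \<Longrightarrow> g \<bullet> (a - c) = 1"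
  shows "is_lattice_pyramid_over_simplex (convex hull C)"
proof -
  have fin: "finite C" by (rule aff_independent_finite[OF indep])
  have card': "card (C - {a}) = CARD('n)"
    using card a fin by simp
  then have "C - {a} \<noteq> {}"
    by (metis card.empty zero_less_card_finite less_irrefl)
  then obtain b where b: "b \<in> C - {a}" by blast
  obtain k :: 'n where True by blast
  obtain U where U: "unimodular U" "U *v axis k 1 = g" "(a - b) v* U = axis k 1"
    by (rule unimodular_completion[of g "a - b" k])
       (use g b a C in \<open>auto intro: integer_points_diff\<close>)
  define w where "w = - (b v* U)"
  define f where "f = (\<lambda>x. x v* U + w)"
  have f_diff: "f x = (x - b) v* U" for x
    by (simp add: f_def w_def vector_matrix_mult_diff_distrib)
  have w: "w \<in> integer_points"
    unfolding w_def using b C U(1) by (auto intro!: integer_points_uminus integer_points_vec_mult)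
  have lin: "linear (\<lambda>x. x v* U)"
    using matrix_vector_mul_linear[of "transpose U"] by simp
  have "det U \<noteq> 0"
    using U(1) by (auto simp: unimodular_def)
  moreover have "det U \<noteq> 0 \<longleftrightarrow> inj ((*v) (transpose U))"
    using det_nz_iff_inj[OF matrix_vector_mul_linear[of "transpose U"]]
    by (simp only: matrix_of_matrix_vector_mul det_transpose)
  ultimately have inj: "inj (\<lambda>x. x v* U)"
    unfolding transpose_matrix_vector by blast
  have f_image: "f ` X = (+) w ` (\<lambda>x. x v* U) ` X" for X
    by (auto simp: f_def image_image add.commute)
  have inj_f: "inj f"
    using inj by (auto simp: inj_def f_def)
  define D where "D = f ` (C - {a})"
  have card_D: "card D = CARD('n)"
    unfolding D_def using card' inj_f by (simp add: card_image inj_on_subset)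
  have "aff_dim D = aff_dim (C - {a})"
    unfolding D_def f_image aff_dim_translation_eq
    by (rule aff_dim_injective_linear_image[OF lin inj])
  also have "\<dots> = int CARD('n) - 1"
    using indep card' by (metis affine_independent_Diff affine_independent_iff_card)
  finally have D_indep: "\<not> affine_dependent D"
    using fin by (simp add: affine_independent_iff_card card_D) (simp add: D_def)
  have D_int: "D \<subseteq> integer_points"
    using C w U(1) by (auto simp: D_def f_def intro!: integer_points_add integer_points_vec_mult)
  have D_height: "D \<subseteq> coordinate_hyperplane k"
  proof
    fix x assume "x \<in> D"
    then obtain c where c: "c \<in> C - {a}" "x = f c" by (auto simp: D_def)
    have "x $ k = x \<bullet> axis k 1" by (simp add: inner_axis)
    also have "\<dots> = (c - b) \<bullet> g"
      by (simp add: c(2) f_diff dot_lmul_matrix U(2))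
    also have "\<dots> = g \<bullet> (a - b) - g \<bullet> (a - c)"
      by (simp add: inner_commute inner_diff_right)
    also have "\<dots> = 0" using g(2) b c by simp
    finally show "x \<in> coordinate_hyperplane k" by (simp add: coordinate_hyperplane_def)
  qed
  have "convex (coordinate_hyperplane k)"
    unfolding coordinate_hyperplane_def
    by (auto simp: convex_def)
  then have B1: "convex hull D \<subseteq> coordinate_hyperplane k"
    using D_height by (rule hull_minimal[rotated])
  have "(int CARD('n) - 1) simplex (convex hull D)"
    unfolding simplex_def using D_indep card_D by (intro exI[of _ D]) simp
  moreover have "lattice_polytope (convex hull D)"
    unfolding lattice_polytope_def polytope_def
    using D_int extreme_point_of_convex_hull aff_independent_finite[OF D_indep] by blast
  ultimately have B2: "lattice_simplex (int CARD('n) - 1) (convex hull D)"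
    by (simp add: lattice_simplex_def)
  have "f a = axis k 1" by (simp add: f_diff U(3))
  then have fC: "insert (axis k 1) D = f ` C"
    using a unfolding D_def by (metis image_insert insert_Diff)
  have "lattice_pyramid k (convex hull D) = convex hull (f ` C)"
    unfolding lattice_pyramid_def fC[symmetric] by (rule hull_insert[symmetric])
  also have "\<dots> = f ` (convex hull C)"
    unfolding f_image convex_hull_translation by (simp only: convex_hull_linear_image[OF lin])
  finally have B3: "unimodularly_equivalent (convex hull C) (lattice_pyramid k (convex hull D))"
    unfolding unimodularly_equivalent_def f_def using U(1) w unimodular_def by blast
  show ?thesis
    unfolding is_lattice_pyramid_over_simplex_def using B1 B2 B3 by blast
qed

section \<open>Two facts about determinants\<close>

text \<open>
  Adding all rows to row \<open>k\<close> turns that row into \<open>(d + 1, ..., d + 1)\<close>, where \<open>d\<close> is the dimension.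
  The same matrix arises from the identity with this row put in place \<open>k\<close>, of determinant \<open>d + 1\<close>,
  by adding \<open>1 / (d + 1)\<close> times row \<open>k\<close> to the other rows.
\<close>

lemma det_mat_1_plus_ones:
  "det (\<chi> i j. of_bool (i = j) + 1 :: real^'n^'n) = real CARD('n) + 1"
proof -
  obtain k :: 'n where True by blast
  define M where "M = (\<chi> i j. of_bool (i = j) + 1 :: real^'n^'n)"
  define e :: "real^'n" where "e = (\<chi> i. 1)"
  define d where "d = real CARD('n) + 1"
  have d: "d \<noteq> 0" unfolding d_def by linarith
  define T where "T = transpose (identity_with_row k (\<chi> i. if i = k then 1 else 1 / d))"
  have "(identity_with_row k e ** M) $ i $ j = (T ** identity_with_row k (d *\<^sub>R e)) $ i $ j" for i j
  proof (cases "i = k")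
    case True
    have "(identity_with_row k e ** M) $ i $ j = (\<Sum>l\<in>UNIV. (if l = j then 1 else 0) + 1)"
      unfolding matrix_matrix_mult_def vec_lambda_beta
      by (rule sum.cong) (auto simp: identity_with_row_nth M_def e_def True)
    also have "\<dots> = d" by (simp add: sum.distrib d_def)
    also have "\<dots> = (\<Sum>l\<in>UNIV. if l = k then d else 0)" by simp
    also have "\<dots> = (T ** identity_with_row k (d *\<^sub>R e)) $ i $ j"
      unfolding matrix_matrix_mult_def vec_lambda_beta
      by (rule sum.cong) (auto simp: T_def transpose_def identity_with_row_nth e_def True)
    finally show ?thesis .
  next
    case False
    have "(identity_with_row k e ** M) $ i $ j = (\<Sum>l\<in>UNIV. if l = i then M $ l $ j else 0)"
      unfolding matrix_matrix_mult_def vec_lambda_beta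
      by (rule sum.cong) (auto simp: identity_with_row_nth False)
    also have "\<dots> = 1 + of_bool (i = j)" by (simp add: M_def)
    also have "\<dots> = (\<Sum>l\<in>UNIV. (if l = k then 1 else 0) + (if l = i then of_bool (l = j) else 0))"
      by (simp add: sum.distrib)
    also have "\<dots> = (T ** identity_with_row k (d *\<^sub>R e)) $ i $ j"
      unfolding matrix_matrix_mult_def vec_lambda_beta
      by (rule sum.cong) (use False d in \<open>auto simp: T_def transpose_def identity_with_row_nth e_def\<close>)
    finally show ?thesis .
  qed
  then have "identity_with_row k e ** M = T ** identity_with_row k (d *\<^sub>R e)"
    by (simp add: vec_eq_iff)
  then have "det (identity_with_row k e) * det M = det T * det (identity_with_row k (d *\<^sub>R e))"
    by (metis det_mul)
  then show ?thesis
    by (simp add: det_identity_with_row T_def det_transpose e_def M_def d_def)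
qed

lemma det_in_Ints:
  fixes A :: "real^'n^'n"
  assumes "\<And>i j. A $ i $ j \<in> \<int>"
  shows "det A \<in> \<int>"
  unfolding det_def by (intro Ints_sum Ints_mult Ints_prod Ints_of_int assms)

section \<open>Barycentric coordinates\<close>

text \<open>
  The vector \<open>g a\<close> is the gradient of the barycentric coordinate belonging to \<open>a\<close>. Only differences of
  vertices enter, so that no base vertex has to be chosen.
\<close>

definition barycentric_gradients :: "(real^'n) set \<Rightarrow> (real^'n \<Rightarrow> real^'n) \<Rightarrow> bool" where
  "barycentric_gradients C g \<longleftrightarrow>
     (\<forall>a\<in>C. \<forall>b\<in>C. \<forall>c\<in>C. g a \<bullet> (b - c) = of_bool (b = a) - of_bool (c = a))"

lemma enumerate_other_vertices:
  fixes C :: "(real^'n) set"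
  assumes "card C = CARD('n) + 1" "b \<in> C"
  obtains v :: "'n \<Rightarrow> real^'n" where "bij_betw v UNIV (C - {b})"
proof -
  have "finite C" using assms(1) card.infinite by fastforce
  then have "card (UNIV :: 'n set) = card (C - {b})"
    using assms by simp
  then show ?thesis
    using that finite_same_card_bij[of "UNIV :: 'n set" "C - {b}"] \<open>finite C\<close> by auto
qed

lemma normalized_volume_simplex_enumerated:
  fixes C :: "(real^'n) set" and y :: "real^'n \<Rightarrow> real^'n"
  assumes "b \<in> C" "bij_betw v UNIV (C - {b})"
  shows "normalized_volume (convex hull (y ` C)) = \<bar>det (\<chi> i. y (v i) - y b)\<bar>"
proof -
  have "C = insert b (range v)"
    using assms by (auto simp: bij_betw_def)
  then have "y ` C = insert (y b) (range (\<lambda>i. y (v i)))" by auto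
  then show ?thesis by (simp add: normalized_volume_simplex)
qed

lemma exists_other_vertex:
  fixes C :: "(real^'n) set"
  assumes "card C = CARD('n) + 1"
  obtains b where "b \<in> C" "b \<noteq> a"
proof -
  have "\<not> C \<subseteq> {a}"
    using assms card_mono[of "{a}" C] zero_less_card_finite[where 'a = 'n] by auto
  then show ?thesis using that by blast
qed

text \<open>
  In the basis of edges from a vertex \<open>b\<close>, the gradient solves a linear system with an integral
  matrix of determinant plus or minus \<open>p\<close>. By Cramer's rule its entries are integers divided by
  this determinant.
\<close>

lemma barycentric_gradients_exist:
  fixes C :: "(real^'n) set"
  assumes card: "card C = CARD('n) + 1" and C: "C \<subseteq> integer_points"
    and vol: "normalized_volume (convex hull C) = p" "p \<noteq> 0"
  obtains g where "barycentric_gradients C g" "\<And>a. a \<in> C \<Longrightarrow> p *\<^sub>R g a \<in> integer_points"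
proof -
  have "\<exists>g. (\<forall>b\<in>C. \<forall>c\<in>C. g \<bullet> (b - c) = of_bool (b = a) - of_bool (c = a)) \<and> p *\<^sub>R g \<in> integer_points"
    if a: "a \<in> C" for a
  proof -
    obtain b where b: "b \<in> C" "b \<noteq> a" by (rule exists_other_vertex[OF card])
    obtain v :: "'n \<Rightarrow> real^'n" where v: "bij_betw v UNIV (C - {b})"
      by (rule enumerate_other_vertices[OF card b(1)])
    then have "a \<in> range v"
      using a b(2) by (simp add: bij_betw_def)
    then obtain k where k: "v k = a" by blast
    define V where "V = (\<chi> i. v i - b)"
    have detV: "\<bar>det V\<bar> = p"
      using normalized_volume_simplex_enumerated[OF b(1) v, of "\<lambda>x. x"] vol(1) by (simp add: V_def)
    define N where "N j = (\<chi> i l. if l = j then axis k 1 $ i else V $ i $ l)" for j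
    define g where "g = (\<chi> j. det (N j) / det V)"
    have "V *v g = axis k 1"
      using cramer[of V g "axis k 1"] detV vol(2) by (auto simp: g_def N_def)
    then have row: "g \<bullet> (v i - b) = of_bool (i = k)" for i
    proof -
      have "(v i - b) \<bullet> g = axis k 1 $ i"
        unfolding \<open>V *v g = axis k 1\<close>[symmetric] matrix_vector_mul_component V_def by simp
      then show ?thesis by (simp add: inner_commute axis_def)
    qed
    have coord: "g \<bullet> (c - b) = of_bool (c = a)" if "c \<in> C" for c
    proof (cases "c = b")
      case False
      then have "c \<in> range v"
        using that v by (simp add: bij_betw_def)
      then obtain i where i: "c = v i" by blast
      have "i = k \<longleftrightarrow> v i = a"
        using v k by (auto simp: bij_betw_def inj_eq)
      then show ?thesis using row i by simp
    qed (use b(2) in auto)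
    have "g \<bullet> (x - c) = of_bool (x = a) - of_bool (c = a)" if "x \<in> C" "c \<in> C" for x c
    proof -
      have "g \<bullet> (x - c) = g \<bullet> (x - b) - g \<bullet> (c - b)" by (simp add: inner_diff_right)
      then show ?thesis by (simp add: coord that)
    qed
    moreover have "p *\<^sub>R g \<in> integer_points"
    proof -
      have "v i \<in> integer_points" "b \<in> integer_points" for i
        using v b C by (auto simp: bij_betw_def)
      then have "N j $ i $ l \<in> \<int>" for i j l
        by (auto simp: N_def V_def axis_def integer_points_def)
      then have "det (N j) \<in> \<int>" for j by (rule det_in_Ints)
      moreover have "p * (det (N j) / det V) = sgn (det V) * det (N j)" for j
        using detV vol(2) by (auto simp: abs_if sgn_if split: if_splits)
      ultimately show ?thesis
        by (auto simp: integer_points_def g_def sgn_if)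
    qed
    ultimately show ?thesis by blast
  qed
  then obtain g where "\<forall>a\<in>C. (\<forall>b\<in>C. \<forall>c\<in>C. g a \<bullet> (b - c) = of_bool (b = a) - of_bool (c = a)) \<and>
      p *\<^sub>R g a \<in> integer_points"
    by metis
  then show ?thesis
    by (intro that[of g]) (auto simp: barycentric_gradients_def)
qed

lemma orthogonal_to_edges_imp_zero:
  fixes C :: "(real^'n) set"
  assumes card: "card C = CARD('n) + 1" and vol: "normalized_volume (convex hull C) \<noteq> 0"
    and x: "\<And>b c. b \<in> C \<Longrightarrow> c \<in> C \<Longrightarrow> x \<bullet> (b - c) = 0"
  shows "x = 0"
proof -
  obtain b where b: "b \<in> C" by (rule exists_other_vertex[OF card])
  obtain v :: "'n \<Rightarrow> real^'n" where v: "bij_betw v UNIV (C - {b})"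
    by (rule enumerate_other_vertices[OF card b])
  define V where "V = (\<chi> i. v i - b)"
  have "det V \<noteq> 0"
    using normalized_volume_simplex_enumerated[OF b v, of "\<lambda>x. x"] vol by (simp add: V_def)
  moreover have "det V \<noteq> 0 \<longleftrightarrow> inj ((*v) V)"
    using det_nz_iff_inj[OF matrix_vector_mul_linear[of V]] by (simp only: matrix_of_matrix_vector_mul)
  ultimately have inj: "inj ((*v) V)" by simp
  have "v i \<in> C" for i using v by (auto simp: bij_betw_def)
  then have "V *v x = V *v 0"
    by (simp add: vec_eq_iff matrix_vector_mul_component V_def x b inner_commute)
  then show ?thesis by (rule injD[OF inj])
qed

section \<open>The dual of a simplex\<close>

lemma dual_polytope_convex_hull: "dual_polytope (convex hull X) = dual_polytope X"
proof
  show "dual_polytope (convex hull X) \<subseteq> dual_polytope X"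
    by (auto simp: dual_polytope_def hull_inc)
  have "convex hull X \<subseteq> {x. y \<bullet> x \<le> 1}" if "y \<in> dual_polytope X" for y
    using that by (intro hull_minimal convex_halfspace_le) (auto simp: dual_polytope_def inner_commute)
  then show "dual_polytope X \<subseteq> dual_polytope (convex hull X)"
    by (auto simp: dual_polytope_def inner_commute)
qed

text \<open>
  Put \<open>q c = r *\<^sub>R c - t\<close> for the translated vertices; their only linear relation is that they sum to
  0 with weights \<open>\<gamma>\<close>. Each \<open>y a\<close> has inner product 1 with all \<open>q c\<close> except \<open>q a\<close>, so \<open>d\<close> of the
  \<open>d + 1\<close> inequalities that define \<open>D\<close> are tight at \<open>y a\<close>. This makes \<open>y a\<close> extreme. A point \<open>x\<close> of \<open>D\<close>
  is a convex combination of the \<open>y a\<close> with weights proportional to \<open>\<gamma> a\<close> times the slack of \<open>x\<close> in the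
  inequality of \<open>q a\<close>.
\<close>

lemma dual_simplex:
  fixes C :: "(real^'n) set"
  assumes fin: "finite C" and g: "barycentric_gradients C g"
    and sep: "\<And>x. (\<And>b c. b \<in> C \<Longrightarrow> c \<in> C \<Longrightarrow> x \<bullet> (b - c) = 0) \<Longrightarrow> x = 0"
    and \<gamma>: "\<And>c. c \<in> C \<Longrightarrow> 0 < \<gamma> c" "sum \<gamma> C = r" "r > 0" and t: "t = (\<Sum>c\<in>C. \<gamma> c *\<^sub>R c)"
  defines "y \<equiv> \<lambda>a. - (1 / \<gamma> a) *\<^sub>R g a"
    and "D \<equiv> dual_polytope ((\<lambda>x. r *\<^sub>R x - t) ` (convex hull C))"
  shows "D = convex hull (y ` C)" "\<And>a. a \<in> C \<Longrightarrow> y a extreme_point_of D"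
proof -
  define q where "q c = r *\<^sub>R c - t" for c
  have D: "D = {x. \<forall>c\<in>C. q c \<bullet> x \<le> 1}"
  proof -
    have "(\<lambda>x. r *\<^sub>R x - t) ` (convex hull C) = convex hull (q ` C)"
      using convex_hull_affinity[of "- t" r C] by (simp add: q_def[abs_def])
    then show ?thesis
      by (simp add: D_def dual_polytope_convex_hull) (auto simp: dual_polytope_def)
  qed
  have q_sum: "(\<Sum>c\<in>C. \<gamma> c *\<^sub>R q c) = 0"
  proof -
    have "(\<Sum>c\<in>C. \<gamma> c *\<^sub>R q c) = r *\<^sub>R (\<Sum>c\<in>C. \<gamma> c *\<^sub>R c) - sum \<gamma> C *\<^sub>R t"
      by (simp add: q_def scaleR_diff_right sum_subtractf scaleR_sum_right scaleR_sum_left mult.commute)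
    then show ?thesis using \<gamma>(2) t by simp
  qed
  have yq: "q c \<bullet> y a = 1 - of_bool (c = a) * (r / \<gamma> a)" if ac: "a \<in> C" "c \<in> C" for a c
  proof -
    have "q c = (\<Sum>b\<in>C. \<gamma> b *\<^sub>R (c - b))"
      by (simp add: q_def t \<gamma>(2)[symmetric] scaleR_diff_right sum_subtractf scaleR_sum_left)
    then have "q c \<bullet> g a = (\<Sum>b\<in>C. \<gamma> b * (g a \<bullet> (c - b)))"
      by (subst inner_commute) (simp only: inner_sum_right inner_scaleR_right)
    also have "\<dots> = (\<Sum>b\<in>C. \<gamma> b * (of_bool (c = a) - of_bool (b = a)))"
      using g ac by (intro sum.cong) (auto simp: barycentric_gradients_def)
    also have "\<dots> = (\<Sum>b\<in>C. of_bool (c = a) * \<gamma> b - (if b = a then \<gamma> b else 0))"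
      by (intro sum.cong) (auto simp: algebra_simps)
    also have "\<dots> = of_bool (c = a) * r - \<gamma> a"
      using fin ac \<gamma>(2) by (cases "c = a") (auto simp: sum_subtractf sum_negf)
    finally show ?thesis
      using \<gamma>(1)[OF ac(1)] by (simp add: y_def field_simps)
  qed
  have y_D: "y a \<in> D" if "a \<in> C" for a
    using that \<gamma> by (auto simp: D yq less_imp_le)
  have determined: "x = z" if "\<And>c. c \<in> C \<Longrightarrow> q c \<bullet> x = q c \<bullet> z" for x z
  proof -
    have "(x - z) \<bullet> (b - c) = 0" if "b \<in> C" "c \<in> C" for b c
    proof -
      have "r * ((x - z) \<bullet> (b - c)) = (q b \<bullet> x - q b \<bullet> z) - (q c \<bullet> x - q c \<bullet> z)"
        by (simp add: q_def inner_diff_left inner_diff_right inner_commute algebra_simps)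
      also have "\<dots> = 0" using \<open>\<And>c. c \<in> C \<Longrightarrow> q c \<bullet> x = q c \<bullet> z\<close> that by simp
      finally show ?thesis using \<gamma>(3) by simp
    qed
    then have "x - z = 0" by (rule sep)
    then show ?thesis by simp
  qed
  show "D = convex hull (y ` C)"
  proof
    have "convex D" unfolding D by (auto simp: convex_def inner_add_right intro!: convex_bound_le)
    then show "convex hull (y ` C) \<subseteq> D"
      using y_D by (intro hull_minimal) auto
    show "D \<subseteq> convex hull (y ` C)"
    proof
      fix x assume x: "x \<in> D"
      define l where "l a = \<gamma> a * (1 - q a \<bullet> x) / r" for a
      have "(\<Sum>c\<in>C. \<gamma> c * (q c \<bullet> x)) = 0"
        using arg_cong[OF q_sum, of "\<lambda>z. z \<bullet> x"] by (simp add: inner_sum_left)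
      then have l_sum: "sum l C = 1"
        using \<gamma>(2,3) by (simp add: l_def sum_divide_distrib[symmetric] algebra_simps sum_subtractf)
      have l_nonneg: "l a \<ge> 0" if "a \<in> C" for a
        using x that \<gamma>(1)[OF that] \<gamma>(3) by (auto simp: l_def D)
      have "q c \<bullet> x = q c \<bullet> (\<Sum>a\<in>C. l a *\<^sub>R y a)" if c: "c \<in> C" for c
      proof -
        have "q c \<bullet> (\<Sum>a\<in>C. l a *\<^sub>R y a) = (\<Sum>a\<in>C. l a - (if a = c then l a * (r / \<gamma> a) else 0))"
          unfolding inner_sum_right using c by (intro sum.cong) (auto simp: yq algebra_simps)
        also have "\<dots> = 1 - l c * (r / \<gamma> c)"
          using fin c by (simp add: sum_subtractf l_sum)
        also have "\<dots> = q c \<bullet> x"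
          using \<gamma>(1)[OF c] \<gamma>(3) by (simp add: l_def)
        finally show ?thesis by simp
      qed
      then have "x = (\<Sum>a\<in>C. l a *\<^sub>R y a)" by (rule determined)
      also have "\<dots> \<in> convex hull (y ` C)"
        using fin l_sum l_nonneg by (intro convex_sum) (auto simp: hull_inc)
      finally show "x \<in> convex hull (y ` C)" .
    qed
  qed
  show "y a extreme_point_of D" if a: "a \<in> C" for a
    unfolding extreme_point_of_def
  proof (intro conjI ballI y_D[OF a] notI)
    fix x z assume xz: "x \<in> D" "z \<in> D" and seg: "y a \<in> open_segment x z"
    then obtain u where u: "x \<noteq> z" "0 < u" "u < 1" "y a = (1 - u) *\<^sub>R x + u *\<^sub>R z"
      by (auto simp: in_segment)
    have q_eq: "q c \<bullet> x = q c \<bullet> z" if c: "c \<in> C" "c \<noteq> a" for c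
    proof -
      have le: "q c \<bullet> x \<le> 1" "q c \<bullet> z \<le> 1" using xz c by (auto simp: D)
      have "(1 - u) * (1 - q c \<bullet> x) + u * (1 - q c \<bullet> z) = 1 - q c \<bullet> y a"
        by (simp add: u(4) inner_add_right algebra_simps)
      also have "\<dots> = 0" using c a by (simp add: yq)
      finally have "(1 - u) * (1 - q c \<bullet> x) = 0 \<and> u * (1 - q c \<bullet> z) = 0"
        using le u(2,3) by (subst (asm) add_nonneg_eq_0_iff) auto
      then show ?thesis using u(2,3) by simp
    qed
    have "(\<Sum>c\<in>C. \<gamma> c * (q c \<bullet> (x - z))) = 0"
      using arg_cong[OF q_sum, of "\<lambda>w. w \<bullet> (x - z)"] by (simp add: inner_sum_left)
    then have "\<gamma> a * (q a \<bullet> (x - z)) = 0"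
      using fin a by (simp add: sum.remove[of C a] q_eq inner_diff_right)
    then have "q a \<bullet> x = q a \<bullet> z"
      using \<gamma>(1)[OF a] by (simp add: inner_diff_right)
    then have "x = z" using q_eq determined by metis
    with u(1) show False by simp
  qed
qed

section \<open>Gorenstein simplices of prime volume\<close>

theorem corollary4p2:
  fixes p r :: nat and \<Delta> :: "(real ^ 'n) set" and t :: "real ^ 'n"
  assumes "prime p"
    and "r > 0"
    and "lattice_simplex (int CARD('n)) \<Delta>"
    and "gorenstein r \<Delta>"
    and "normalized_volume \<Delta> = real p"
    and "\<not> is_lattice_pyramid_over_simplex \<Delta>"
    and "interior_lattice_points ((\<lambda>x. real r *\<^sub>R x) ` \<Delta>) = {t}"
  shows "normalized_volume (dual_polytope ((\<lambda>x. real r *\<^sub>R x - t) ` \<Delta>)) = real r * real p ^ CARD('n)"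
proof -
  obtain C where indep: "\<not> affine_dependent C" and card: "card C = CARD('n) + 1"
    and \<Delta>: "\<Delta> = convex hull C"
    using assms(3) by (auto simp: lattice_simplex_def simplex_def)
  have C_int: "C \<subseteq> integer_points"
    using assms(3) extreme_point_of_convex_hull_affine_independent[OF indep]
    by (auto simp: lattice_simplex_def lattice_polytope_def \<Delta>)
  have fin: "finite C" by (rule aff_independent_finite[OF indep])
  have p0: "real p \<noteq> 0" and p1: "p > 0" using assms(1) prime_gt_0_nat by auto
  have vol: "normalized_volume (convex hull C) = real p" using assms(5) \<Delta> by simp
  obtain g where g: "barycentric_gradients C g" and pg: "\<And>a. a \<in> C \<Longrightarrow> real p *\<^sub>R g a \<in> integer_points"
    using barycentric_gradients_exist[OF card C_int vol p0] by blast
  have sep: "x = 0" if "\<And>b c. b \<in> C \<Longrightarrow> c \<in> C \<Longrightarrow> x \<bullet> (b - c) = 0" for x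
    using orthogonal_to_edges_imp_zero[OF card _ that] vol p0 by simp
  define D where "D = dual_polytope ((\<lambda>x. real r *\<^sub>R x - t) ` \<Delta>)"
  have t_int: "t \<in> integer_points" and t_interior: "t \<in> interior ((\<lambda>x. real r *\<^sub>R x) ` \<Delta>)"
    using assms(7) by (auto simp: interior_lattice_points_def)
  have D_lattice: "lattice_polytope D"
  proof -
    obtain Q w where Q: "reflexive_polytope Q" "w \<in> integer_points" "Q = (\<lambda>x. real r *\<^sub>R x + w) ` \<Delta>"
      using assms(4) by (auto simp: gorenstein_def)
    have "Q = (+) w ` (\<lambda>x. real r *\<^sub>R x) ` \<Delta>"
      by (auto simp: Q(3) image_image add.commute)
    then have "interior Q = (+) w ` interior ((\<lambda>x. real r *\<^sub>R x) ` \<Delta>)"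
      by (simp only: interior_translation)
    moreover have "0 \<in> interior Q"
      using Q(1) by (auto simp: reflexive_polytope_def interior_lattice_points_def)
    ultimately have "- w \<in> interior ((\<lambda>x. real r *\<^sub>R x) ` \<Delta>)"
      by (metis (no_types, lifting) add_eq_0_iff imageE minus_equation_iff)
    then have "- w = t"
      using assms(7) integer_points_uminus[OF Q(2)] by (auto simp: interior_lattice_points_def)
    then have "Q = (\<lambda>x. real r *\<^sub>R x - t) ` \<Delta>"
      using Q(3) by auto
    then show ?thesis
      using Q(1) by (simp add: reflexive_polytope_def D_def)
  qed
  have "interior ((\<lambda>x. real r *\<^sub>R x) ` \<Delta>) = (\<lambda>x. real r *\<^sub>R x) ` interior \<Delta>"
    using assms(2) by (intro interior_injective_linear_image) (auto intro: injective_scaleR linear_scaleR)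
  then obtain s where s: "s \<in> interior (convex hull C)" "t = real r *\<^sub>R s"
    using t_interior \<Delta> by auto
  then obtain u where u: "\<And>c. c \<in> C \<Longrightarrow> u c > 0" "sum u C = 1" "(\<Sum>c\<in>C. u c *\<^sub>R c) = s"
    using interior_convex_hull_explicit_minimal[OF indep] by (auto split: if_splits)
  define \<gamma> where "\<gamma> c = real r * u c" for c
  have \<gamma>_pos: "\<gamma> c > 0" if "c \<in> C" for c using u(1)[OF that] assms(2) by (simp add: \<gamma>_def)
  have \<gamma>_sum: "sum \<gamma> C = real r" using u(2) by (simp add: \<gamma>_def sum_distrib_left[symmetric])
  have t_\<gamma>: "t = (\<Sum>c\<in>C. \<gamma> c *\<^sub>R c)" 
    unfolding s(2) u(3)[symmetric] by (simp add: \<gamma>_def scaleR_sum_right)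
  have r0: "real r > 0" using assms(2) by simp
  define y where "y a = - (1 / \<gamma> a) *\<^sub>R g a" for a
  have D_hull: "D = convex hull (y ` C)" and y_extreme: "y a extreme_point_of D" if "a \<in> C" for a
    unfolding D_def \<Delta> y_def[abs_def]
    using dual_simplex[OF fin g sep \<gamma>_pos \<gamma>_sum r0 t_\<gamma>] that by blast+
  have \<gamma>_eq: "\<gamma> a = 1 / real p" if a: "a \<in> C" for a
  proof -
    obtain b where b: "b \<in> C" "b \<noteq> a" by (rule exists_other_vertex[OF card])
    have ga: "g a \<bullet> (c - d) = of_bool (c = a) - of_bool (d = a)" if "c \<in> C" "d \<in> C" for c d
      using g a that by (simp add: barycentric_gradients_def)
    have y_int: "y a \<in> integer_points"
      using D_lattice y_extreme[OF a] by (simp add: lattice_polytope_def)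
    \<comment> \<open>The dual vertex and the edge are both integral.\<close>
    have "y a \<bullet> (b - a) = 1 / \<gamma> a"
      using ga[OF b(1) a] b(2) by (simp add: y_def)
    then have inv_int: "1 / \<gamma> a \<in> \<int>"
      using inner_integer_points[OF y_int integer_points_diff] C_int a b(1) by fastforce
    \<comment> \<open>The gradient at a recovers the coordinate of the lattice point t, measured from the vertex
      r b of the dilated simplex, which lies on the facet opposite to r a.\<close>
    have "t - real r *\<^sub>R b = (\<Sum>c\<in>C. \<gamma> c *\<^sub>R (c - b))"
      by (simp add: t_\<gamma> \<gamma>_sum[symmetric] scaleR_diff_right sum_subtractf scaleR_sum_left)
    then have "g a \<bullet> (t - real r *\<^sub>R b) = (\<Sum>c\<in>C. \<gamma> c * (g a \<bullet> (c - b)))"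
      by (simp only: inner_sum_right inner_scaleR_right)
    also have "\<dots> = (\<Sum>c\<in>C. if c = a then \<gamma> c else 0)"
      using ga b by (intro sum.cong) auto
    finally have "g a \<bullet> (t - real r *\<^sub>R b) = \<gamma> a" using fin a by simp
    then have "real p * \<gamma> a = (real p *\<^sub>R g a) \<bullet> (t - real r *\<^sub>R b)" by simp
    moreover have "t - real r *\<^sub>R b \<in> integer_points"
      using t_int C_int b(1) by (intro integer_points_diff integer_points_scaleR) auto
    ultimately have p_int: "real p * \<gamma> a \<in> \<int>"
      using inner_integer_points[OF pg[OF a]] by metis
    have pos: "1 / \<gamma> a > 0" "real p * \<gamma> a > 0" using \<gamma>_pos[OF a] p1 by auto
    obtain m where m: "1 / \<gamma> a = real m"
      using inv_int pos(1) by (metis Ints_cases int_nat_eq less_imp_le of_int_0_le_iff of_int_of_nat_eq)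
    obtain k where k: "real p * \<gamma> a = real k"
      using p_int pos(2) by (metis Ints_cases int_nat_eq less_imp_le of_int_0_le_iff of_int_of_nat_eq)
    have "real p = real (m * k)"
      using m k pos by (simp add: field_simps flip: m k)
    then have "m dvd p" by (metis dvd_triv_left of_nat_eq_iff)
    then have "m = 1 \<or> m = p" using assms(1) prime_nat_iff by blast
    moreover have "m \<noteq> 1"
    proof
      assume "m = 1"
      then have "g a = - y a" using m by (simp add: y_def)
      then have "g a \<in> integer_points" using integer_points_uminus[OF y_int] by simp
      moreover have "g a \<bullet> (a - c) = 1" if "c \<in> C - {a}" for c using ga[of a c] a that by simp
      ultimately show False
        using lattice_pyramid_if_integral_facet_functional[OF indep card C_int a] assms(6) \<Delta> by blast
    qed
    ultimately have "1 / \<gamma> a = real p" using m by simp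
    then have "1 / real p = 1 / (1 / \<gamma> a)" by simp
    then show ?thesis by simp
  qed
  have "(\<Sum>c\<in>C. 1 / real p) = real r"
    using \<gamma>_sum \<gamma>_eq by simp
  then have rp: "real CARD('n) + 1 = real r * real p"
    using card p0 by (simp add: field_simps)
  have y_eq: "y a = - real p *\<^sub>R g a" if "a \<in> C" for a
    using \<gamma>_eq[OF that] by (simp add: y_def)
  have g_sum: "(\<Sum>a\<in>C. g a) = 0"
  proof (rule sep)
    fix b c assume bc: "b \<in> C" "c \<in> C"
    have "(\<Sum>a\<in>C. g a) \<bullet> (b - c) = (\<Sum>a\<in>C. (if b = a then 1 else 0) - (if c = a then 1 else 0))"
      unfolding inner_sum_left using g bc by (intro sum.cong) (auto simp: barycentric_gradients_def)
    also have "\<dots> = 0" using fin bc by (simp add: sum_subtractf)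
    finally show "(\<Sum>a\<in>C. g a) \<bullet> (b - c) = 0" .
  qed
  obtain b where b: "b \<in> C" by (rule exists_other_vertex[OF card])
  obtain v :: "'n \<Rightarrow> real^'n" where v: "bij_betw v UNIV (C - {b})"
    by (rule enumerate_other_vertices[OF card b])
  have vC: "v i \<in> C" "v i \<noteq> b" for i using v by (auto simp: bij_betw_def)
  have v_inj: "v i = v j \<longleftrightarrow> i = j" for i j using v by (auto simp: bij_betw_def inj_eq)
  define V where "V = (\<chi> i. v i - b)"
  define G where "G = (\<chi> i. g (v i))"
  define Y where "Y = (\<chi> i. (- real p) *s g (v i))"
  \<comment> \<open>The gradients at the vertices other than b form the basis dual to the edges from b.\<close>
  have "V ** transpose G = mat 1"
  proof -
    have "(V ** transpose G) $ i $ j = of_bool (i = j)" for i j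
    proof -
      have "(V ** transpose G) $ i $ j = g (v j) \<bullet> (v i - b)"
        by (simp add: matrix_matrix_mult_def transpose_def V_def G_def inner_vec_def mult.commute)
      also have "\<dots> = of_bool (v i = v j) - of_bool (b = v j)"
        using g vC(1) b by (simp add: barycentric_gradients_def)
      also have "\<dots> = of_bool (i = j)"
        using vC(2)[of j] v_inj by auto
      finally show ?thesis .
    qed
    then show ?thesis
      by (simp add: vec_eq_iff mat_def)
  qed
  then have "det V * det G = 1"
    by (metis det_I det_mul det_transpose)
  moreover have "\<bar>det V\<bar> = real p"
    using normalized_volume_simplex_enumerated[OF b v, of "\<lambda>x. x"] vol by (simp add: V_def)
  ultimately have det_G: "real p * \<bar>det G\<bar> = 1"
    by (metis abs_mult abs_one)
  have det_Y: "\<bar>det Y\<bar> = real p ^ CARD('n) * \<bar>det G\<bar>"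
    unfolding Y_def det_rows_mul by (simp add: G_def abs_mult power_abs)
  \<comment> \<open>Eliminating the gradient at b makes each edge of the dual simplex a row of Y plus the sum of
    all rows.\<close>
  have "g b = - (\<Sum>i\<in>UNIV. g (v i))"
    using g_sum sum.remove[OF fin b, of g] sum.reindex_bij_betw[OF v, of g] by (simp add: eq_neg_iff_add_eq_0)
  then have "y (v i) - y b = (- real p) *\<^sub>R g (v i) + (\<Sum>j\<in>UNIV. (- real p) *\<^sub>R g (v j))" for i
    by (simp add: y_eq vC b scaleR_sum_right sum_negf)
  then have "(\<chi> i. y (v i) - y b) = (\<chi> i j. of_bool (i = j) + 1) ** Y"
    by (simp add: vec_eq_iff matrix_matrix_mult_def Y_def distrib_right sum.distrib of_bool_def
        if_distrib[of "\<lambda>x. x * _"] sum_negf sum_subtractf cong: if_cong)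
  then have "det (\<chi> i. y (v i) - y b) = (real CARD('n) + 1) * det Y"
    by (simp only: det_mul det_mat_1_plus_ones)
  then have "normalized_volume D = (real CARD('n) + 1) * \<bar>det Y\<bar>"
    using normalized_volume_simplex_enumerated[OF b v, of y] D_hull[OF b] by (simp add: abs_mult)
  also have "\<dots> = real r * real p ^ CARD('n) * (real p * \<bar>det G\<bar>)"
    by (simp add: rp det_Y)
  finally show ?thesis
    by (simp add: det_G D_def)
qed

end
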